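(* Let $A\subset\mathbb{R}$ be a finite set with $|A|\ge2$. Then there is $A_1\subseteq A$ such that $|A_1|\gtrsim \mathbf{E}^\times(A)|A|^{-2}$ and $$\mathbf{E}^+(A_1)\,\mathbf{E}^\times(A)\lesssim |A_1|^{7/2}|A|^2.$$ Similarly, there is $A_2\subseteq A$ such that $|A_2|\gtrsim \mathbf{E}^+(A)|A|^{-2}$ and $$\mathbf{E}^\times(A_2)\,\mathbf{E}^+(A)\lesssim |A_2|^{7/2}|A|^2.$$
   Context: For finite $X\subset\mathbb{R}$: $\mathbf{E}^+(X)=|\{(x_1,x_2,x_3,x_4)\in X^4: x_1+x_2=x_3+x_4\}|$ and $\mathbf{E}^\times(X)=|\{(x_1,x_2,x_3,x_4)\in X^4: x_1x_2=x_3x_4\}|$. Notation: $U\lesssim V$ (or $V\gtrsim U$) means $U=O(V\log^{c}|A|)$ for some absolute constant $c>0$, with an absolute implied constant. *)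

theory Defs
  imports Complex_Main
begin

definition additive_energy :: "real set \<Rightarrow> nat" where
  "additive_energy X =
     card {(x1, x2, x3, x4). x1 \<in> X \<and> x2 \<in> X \<and> x3 \<in> X \<and> x4 \<in> X \<and> x1 + x2 = x3 + x4}"

definition multiplicative_energy :: "real set \<Rightarrow> nat" where
  "multiplicative_energy X =
     card {(x1, x2, x3, x4). x1 \<in> X \<and> x2 \<in> X \<and> x3 \<in> X \<and> x4 \<in> X \<and> x1 * x2 = x3 * x4}"

text \<open>
  The relation between \<open>U\<close> and \<open>V\<close> up to a power of \<open>log |A|\<close>, with the implied constant \<open>C\<close> and
  the exponent \<open>c\<close> of the logarithm explicit. That \<open>C\<close> and \<open>c\<close> are absolute is expressed by
  quantifying them existentially outside the quantifier over \<open>A\<close>.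
\<close>

definition lesssim :: "real \<Rightarrow> real \<Rightarrow> real set \<Rightarrow> real \<Rightarrow> real \<Rightarrow> bool" where
  "lesssim C c A U V \<longleftrightarrow> U \<le> C * (V * ln (real (card A)) powr c)"

end

theory Submission
  imports Defs "HOL-Analysis.Harmonic_Numbers"
begin

text \<open>
  Let \<open>P\<close> be the set of quotients with at least \<open>\<tau>\<close> representations \<open>\<lambda> = x / a\<close> over \<open>A\<close>, with \<open>\<tau>\<close> chosen
  so that \<open>|P| \<tau>\<^sup>2\<close> is the multiplicative energy of \<open>A\<close> up to logarithms, and let \<open>A\<^sub>1\<close> consist of
  those \<open>x \<in> A\<close> that can be written as \<open>x = \<lambda> a\<close> in at least \<open>q\<close> ways with \<open>\<lambda> \<in> P\<close>, where \<open>|A\<^sub>1| q\<close> is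
  \<open>|P| \<tau>\<close> up to logarithms.  If every \<open>s \<in> S\<close> has \<open>t\<close> representations \<open>s = x - b\<close> over \<open>A\<^sub>1\<close>, then
  replacing \<open>x\<close> by \<open>\<lambda> a\<close> yields \<open>q t |S|\<close> incidences between the grid \<open>P \<times> S\<close> and the
  lines \<open>s = a \<lambda> - b\<close>.  The Szemeredi-Trotter bound then gives
  \<open>t\<^sup>3 |S| = O(|A|\<^sup>2 |A\<^sub>1|\<^sup>2 |P|\<^sup>2 / q\<^sup>3)\<close>; combined with \<open>t |S| \<le> |A\<^sub>1|\<^sup>2\<close> this bounds \<open>t\<^sup>2 |S|\<close>, hence the
  additive energy of \<open>A\<^sub>1\<close>.  The second half exchanges the roles of quotients and differences,
  the lines being \<open>s = (\<lambda> + a) / b\<close>.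

  For a grid the Szemeredi-Trotter bound is elementary: cut the grid into cells by axis-parallel
  lines.  A line runs monotonically through the cells, so it meets few of them, and two points in a
  common cell determine the line.
\<close>

subsection \<open>Incidences between lines and a grid\<close>

text \<open>Dividing this rank by \<open>k\<close> cuts a finite set into blocks of at most
  \<open>k\<close> consecutive elements. Such blocks of \<open>X\<close> and of \<open>Y\<close> are
  the columns and rows of the grid cells.\<close>

definition rank_in :: "real set \<Rightarrow> real \<Rightarrow> nat" where
  "rank_in X x = card {z \<in> X. z < x}"

lemma rank_in_mono: "finite X \<Longrightarrow> x \<le> y \<Longrightarrow> rank_in X x \<le> rank_in X y"
  unfolding rank_in_def by (intro card_mono) auto

lemma rank_in_strict_mono:
  assumes "finite X" "x \<in> X" "x < y"
  shows "rank_in X x < rank_in X y"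
  unfolding rank_in_def using assms by (intro psubset_card_mono psubsetI) auto

lemma inj_on_rank_in: "finite X \<Longrightarrow> inj_on (rank_in X) X"
  by (rule linorder_inj_onI) (auto dest: rank_in_strict_mono)

lemma rank_in_le: "finite X \<Longrightarrow> rank_in X x \<le> card X"
  unfolding rank_in_def by (intro card_mono) auto

lemma card_rank_block_le:
  assumes "finite X" "k > 0"
  shows "card {x \<in> X. rank_in X x div k = c} \<le> k"
proof -
  have "card {x \<in> X. rank_in X x div k = c} \<le> card {c * k..<c * k + k}"
  proof (rule card_inj_on_le)
    show "inj_on (rank_in X) {x \<in> X. rank_in X x div k = c}"
      using inj_on_rank_in[OF assms(1)] by (rule inj_on_subset) auto
    show "rank_in X ` {x \<in> X. rank_in X x div k = c} \<subseteq> {c * k..<c * k + k}"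
      using assms(2) dividend_less_div_times[OF assms(2)] by (auto simp: add.commute)
  qed simp
  then show ?thesis by simp
qed

text \<open>Choose one representative in each nonempty fibre of \<open>f\<close>. The
  representatives are counted by the image, and every other element forms a collision with the
  representative of its own fibre.\<close>

lemma card_le_image_plus_collisions:
  assumes "finite Q"
  shows "card Q \<le> card (f ` Q) + card {(x, y). x \<in> Q \<and> y \<in> Q \<and> x \<noteq> y \<and> f x = f y}"
    (is "_ \<le> _ + card ?D")
proof -
  let ?g = "inv_into Q f" and ?R = "inv_into Q f ` f ` Q"
  have R: "?R \<subseteq> Q" by (auto intro: inv_into_into)
  have finD: "finite ?D"
    by (rule finite_subset[of _ "Q \<times> Q"]) (use assms in auto)
  have "card (Q - ?R) \<le> card ?D"
  proof (rule card_inj_on_le)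
    show "inj_on (\<lambda>x. (x, ?g (f x))) (Q - ?R)" by (auto simp: inj_on_def)
    show "(\<lambda>x. (x, ?g (f x))) ` (Q - ?R) \<subseteq> ?D"
    proof (intro image_subsetI)
      fix x assume x: "x \<in> Q - ?R"
      then have "?g (f x) \<in> ?R" by blast
      with x R show "(x, ?g (f x)) \<in> ?D"
        by (auto simp: f_inv_into_f)
    qed
  qed (rule finD)
  moreover have "card ?R \<le> card (f ` Q)"
    using assms by (intro card_image_le) auto
  moreover have "card Q = card ?R + card (Q - ?R)"
    using assms R by (metis card_Diff_subset card_mono finite_subset le_add_diff_inverse)
  ultimately show ?thesis by linarith
qed

text \<open>A line is the pair of its slope and intercept, so vertical lines do not occur. The
  ordinate of a point on it follows from the abscissa, which is therefore all that is
  recorded.\<close>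

definition incidences :: "real set \<Rightarrow> real set \<Rightarrow> (real \<times> real) set \<Rightarrow> ((real \<times> real) \<times> real) set"
  where "incidences X Y L = {(l, x). l \<in> L \<and> x \<in> X \<and> fst l * x + snd l \<in> Y}"

lemma finite_incidences: "finite X \<Longrightarrow> finite L \<Longrightarrow> finite (incidences X Y L)"
  by (rule finite_subset[of _ "L \<times> X"]) (auto simp: incidences_def)

lemma card_incidences_le_X:
  assumes "finite X" "finite L"
  shows "card (incidences X Y L) \<le> card X * card L"
proof -
  have "card (incidences X Y L) \<le> card (L \<times> X)"
    by (rule card_mono) (use assms in \<open>auto simp: incidences_def\<close>)
  then show ?thesis by (simp add: card_cartesian_product mult.commute)
qed

lemma card_incidences_le_Y:
  assumes "finite Y" "finite L" "\<And>l. l \<in> L \<Longrightarrow> fst l \<noteq> 0"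
  shows "card (incidences X Y L) \<le> card Y * card L"
proof -
  have "card (incidences X Y L) \<le> card (L \<times> Y)"
    by (rule card_inj_on_le[where f = "\<lambda>(l, x). (l, fst l * x + snd l)"])
      (use assms in \<open>force simp: incidences_def inj_on_def\<close>)+
  then show ?thesis by (simp add: card_cartesian_product mult.commute)
qed

text \<open>A monotone path through the cells meets at most
  \<open>card X div k + card Y div l + 1\<close> of them. Any surplus of incidences on a line is
  charged to ordered pairs of distinct points in a common cell. Such a pair lies on only one line,
  and there are at most \<open>card X * card Y * k * l\<close> of them.\<close>

lemma card_incidences_cells:
  fixes k l :: nat
  assumes X: "finite X" and Y: "finite Y" and L: "finite L"
    and slope: "\<And>l. l \<in> L \<Longrightarrow> fst l \<noteq> 0" and k: "k > 0" and l: "l > 0"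
  shows "card (incidences X Y L)
    \<le> card L * (card X div k + card Y div l + 1) + card X * card Y * k * l"
proof -
  define bx where "bx x = rank_in X x div k" for x
  define bY where "bY y = rank_in Y y div l" for y
  define Q where "Q g = {x \<in> X. fst g * x + snd g \<in> Y}" for g :: "real \<times> real"
  \<comment> \<open>Both summands are nondecreasing along the line, so their sum determines the cell.\<close>
  define ix where "ix g x = int (bx x) +
      (if fst g > 0 then 1 else - 1) * int (bY (fst g * x + snd g))" for g :: "real \<times> real" and x
  define D where "D g = {(x, x'). x \<in> Q g \<and> x' \<in> Q g \<and> x \<noteq> x' \<and> ix g x = ix g x'}" for g
  \<comment> \<open>The ordered pairs of grid points in a common cell, into which the collisions of
    all lines together will be injected.\<close>
  define W where "W = (SIGMA p : X \<times> Y. {x' \<in> X. bx x' = bx (fst p)} \<times> {y' \<in> Y. bY y' = bY (snd p)})"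
  have bx_mono: "bx x \<le> bx x'" if "x \<le> x'" for x x'
    unfolding bx_def using that X by (intro div_le_mono rank_in_mono)
  have bY_mono: "bY y \<le> bY y'" if "y \<le> y'" for y y'
    unfolding bY_def using that Y by (intro div_le_mono rank_in_mono)
  have bx_le: "bx x \<le> card X div k" for x
    unfolding bx_def using X by (intro div_le_mono rank_in_le)
  have bY_le: "bY y \<le> card Y div l" for y
    unfolding bY_def using Y by (intro div_le_mono rank_in_le)
  have finQ: "finite (Q g)" for g using X by (simp add: Q_def)
  have finD: "finite (D g)" for g
    by (rule finite_subset[of _ "Q g \<times> Q g"]) (use finQ in \<open>auto simp: D_def\<close>)
  have card_ix: "card (ix g ` Q g) \<le> card X div k + card Y div l + 1" if "g \<in> L" for g
  proof (cases "fst g > 0")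
    case True
    have "ix g ` Q g \<subseteq> {0..int (card X div k + card Y div l)}"
      using True bx_le bY_le by (auto simp: ix_def simp flip: of_nat_add intro!: add_mono)
    then have "card (ix g ` Q g) \<le> card {0..int (card X div k + card Y div l)}"
      by (intro card_mono) auto
    then show ?thesis by simp
  next
    case False
    \<comment> \<open>On a falling line the row index enters with a minus sign. The interval of
      possible values is shifted but has as many elements as before.\<close>
    have "ix g x \<in> {- int (card Y div l)..int (card X div k)}" for x
      using False bx_le[of x] bY_le[of "fst g * x + snd g"]
      unfolding ix_def atLeastAtMost_iff by (simp only: if_False) linarith
    then have "ix g ` Q g \<subseteq> {- int (card Y div l)..int (card X div k)}" by blast
    then have "card (ix g ` Q g) \<le> card {- int (card Y div l)..int (card X div k)}"
      by (intro card_mono) auto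
    then show ?thesis by simp
  qed
  have cell_lt: "bx x = bx x' \<and> bY (fst g * x + snd g) = bY (fst g * x' + snd g)"
    if "ix g x = ix g x'" "x < x'" "g \<in> L" for g x x'
  proof (cases "fst g > 0")
    case True
    then have "fst g * x + snd g \<le> fst g * x' + snd g" using that by simp
    then have "bY (fst g * x + snd g) \<le> bY (fst g * x' + snd g)" by (rule bY_mono)
    moreover have "bx x \<le> bx x'" using that by (intro bx_mono) simp
    ultimately show ?thesis using that(1) True unfolding ix_def by simp
  next
    case False
    with slope[OF that(3)] have "fst g < 0" by simp
    then have "fst g * x' + snd g \<le> fst g * x + snd g" using that by simp
    then have "bY (fst g * x' + snd g) \<le> bY (fst g * x + snd g)" by (rule bY_mono)
    moreover have "bx x \<le> bx x'" using that by (intro bx_mono) simp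
    ultimately show ?thesis using that(1) False unfolding ix_def by simp
  qed
  have cell: "bx x' = bx x \<and> bY (fst g * x' + snd g) = bY (fst g * x + snd g)"
    if "(x, x') \<in> D g" "g \<in> L" for g x x'
  proof -
    have ix: "ix g x = ix g x'" and "x < x' \<or> x' < x" using that by (auto simp: D_def)
    from this(2) show ?thesis
    proof
      assume "x < x'"
      from cell_lt[OF ix this that(2)] show ?thesis by simp
    next
      assume "x' < x"
      from cell_lt[OF ix[symmetric] this that(2)] show ?thesis .
    qed
  qed
  have finW: "finite W" unfolding W_def using X Y by auto
  have "(\<Sum>g\<in>L. card (D g)) = card (SIGMA g : L. D g)"
    using L finD by simp
  also have "\<dots> \<le> card W"
  proof (rule card_inj_on_le)
    let ?h = "\<lambda>(g, x, x'). ((x, fst g * x + snd g), x', fst g * x' + snd g)"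
    show "inj_on ?h (SIGMA g : L. D g)"
    proof (rule inj_onI)
      fix u v assume uv: "u \<in> (SIGMA g : L. D g)" "v \<in> (SIGMA g : L. D g)" "?h u = ?h v"
      obtain a b x x' where u: "u = ((a, b), x, x')" by (metis surj_pair)
      obtain c d y y' where v: "v = ((c, d), y, y')" by (metis surj_pair)
      have "x \<noteq> x'" using uv(1) by (simp add: u D_def)
      have e: "x = y" "x' = y'" "a * x + b = c * x + d" "a * x' + b = c * x' + d"
        using uv(3) by (auto simp: u v)
      then have "(a - c) * (x - x') = 0" by (simp add: algebra_simps)
      with \<open>x \<noteq> x'\<close> have "a = c" by simp
      with e show "u = v" by (simp add: u v)
    qed
    show "?h ` (SIGMA g : L. D g) \<subseteq> W"
    proof (clarify)
      fix a b x x' assume "(a, b) \<in> L" "(x, x') \<in> D (a, b)"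
      with cell[of x x' "(a, b)"] show "((x, fst (a, b) * x + snd (a, b)), x', fst (a, b) * x' + snd (a, b)) \<in> W"
        by (auto simp: W_def D_def Q_def)
    qed
  qed (rule finW)
  also have "card W = (\<Sum>p\<in>X \<times> Y. card {x' \<in> X. bx x' = bx (fst p)} * card {y' \<in> Y. bY y' = bY (snd p)})"
    unfolding W_def using X Y by (simp add: card_cartesian_product)
  also have "\<dots> \<le> (\<Sum>p\<in>X \<times> Y. k * l)"
    unfolding bx_def bY_def using X Y k l by (intro sum_mono mult_mono card_rank_block_le) auto
  also have "\<dots> = card X * card Y * k * l" by (simp add: card_cartesian_product)
  finally have D_sum: "(\<Sum>g\<in>L. card (D g)) \<le> card X * card Y * k * l" .
  have "incidences X Y L = (SIGMA g : L. Q g)" by (auto simp: incidences_def Q_def)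
  then have "card (incidences X Y L) = (\<Sum>g\<in>L. card (Q g))"
    using L finQ by simp
  also have "\<dots> \<le> (\<Sum>g\<in>L. (card X div k + card Y div l + 1) + card (D g))"
  proof (rule sum_mono)
    fix g assume "g \<in> L"
    then show "card (Q g) \<le> (card X div k + card Y div l + 1) + card (D g)"
      using card_ix[of g] card_le_image_plus_collisions[OF finQ, of g "ix g"]
      unfolding D_def by linarith
  qed
  also have "\<dots> \<le> card L * (card X div k + card Y div l + 1) + card X * card Y * k * l"
    unfolding sum.distrib using D_sum by (simp add: algebra_simps)
  finally show ?thesis .
qed

lemma card_incidences_cells_real:
  fixes R :: real
  assumes "finite X" "finite Y" "finite L" "\<And>l. l \<in> L \<Longrightarrow> fst l \<noteq> 0"
    and R: "1 \<le> R" "R \<le> card X" "R \<le> card Y"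
  shows "real (card (incidences X Y L))
    \<le> 4 * R * card L + 4 * (real (card X) * real (card Y))\<^sup>2 / R\<^sup>2"
proof -
  define n m where "n = card X" and "m = card Y"
  \<comment> \<open>With these block sizes the grid has about \<open>R\<close> columns and
    \<open>R\<close> rows. As \<open>n / R\<close> and \<open>m / R\<close> are at least 1, rounding
    up at most doubles them, which gives the factor 4 in the second term.\<close>
  define k l where "k = nat \<lceil>n / R\<rceil>" and "l = nat \<lceil>m / R\<rceil>"
  have nR: "n / R \<ge> 1" "m / R \<ge> 1" using R by (auto simp: n_def m_def)
  have kl: "real k \<ge> n / R" "real k \<le> 2 * (n / R)" "real l \<ge> m / R" "real l \<le> 2 * (m / R)"
    using nR unfolding k_def l_def by linarith+
  have pos: "k > 0" "l > 0" using kl nR by (simp_all add: k_def l_def) 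
  have div_le: "real (n div k) \<le> R" "real (m div l) \<le> R"
  proof -
    have "real (n div k) \<le> n / k" by (rule of_nat_div_le_of_nat)
    also have "\<dots> \<le> R" using kl(1) R pos by (simp add: field_simps)
    finally show "real (n div k) \<le> R" .
    have "real (m div l) \<le> m / l" by (rule of_nat_div_le_of_nat)
    also have "\<dots> \<le> R" using kl(3) R pos by (simp add: field_simps)
    finally show "real (m div l) \<le> R" .
  qed
  have "real (card (incidences X Y L)) \<le> real (card L * (n div k + m div l + 1) + n * m * k * l)"
    unfolding n_def m_def of_nat_le_iff using assms pos by (intro card_incidences_cells)
  also have "\<dots> = card L * (real (n div k) + real (m div l) + 1) + real n * real m * (real k * real l)"
    by (simp add: algebra_simps)
  also have "\<dots> \<le> card L * (R + R + 2 * R) + real n * real m * ((2 * (n / R)) * (2 * (m / R)))"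
    using div_le R kl by (intro add_mono mult_mono) auto
  also have "\<dots> = 4 * R * card L + 4 * (real n * real m)\<^sup>2 / R\<^sup>2"
    by (simp add: power2_eq_square field_simps)
  finally show ?thesis by (simp add: n_def m_def)
qed

text \<open>Choosing \<open>R\<close> to balance the two terms of the cell bound gives the usual
  exponent 2/3, stated here as a cube to stay within the natural numbers. The first alternative
  covers the case of so many lines that no subdivision pays off.\<close>

lemma szemeredi_trotter_grid:
  assumes X: "finite X" and Y: "finite Y" and L: "finite L"
    and slope: "\<And>l. l \<in> L \<Longrightarrow> fst l \<noteq> 0"
  shows "card (incidences X Y L) \<le> 8 * card L \<or>
    card (incidences X Y L) ^ 3 \<le> 512 * (card L * card X * card Y)\<^sup>2"
proof (cases "incidences X Y L = {}")
  case True
  then show ?thesis by simp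
next
  case False
  define n m I q where "n = real (card X)" and "m = real (card Y)"
    and "I = real (card (incidences X Y L))" and "q = real (card L)"
  have "X \<noteq> {}" "Y \<noteq> {}" "L \<noteq> {}" using False by (auto simp: incidences_def)
  then have "card X \<ge> 1" "card Y \<ge> 1" "card L \<ge> 1"
    using X Y L by (simp_all add: Suc_le_eq card_gt_0_iff)
  then have pos: "n \<ge> 1" "m \<ge> 1" "q \<ge> 1" by (simp_all add: n_def m_def q_def)
  \<comment> \<open>The value of \<open>R\<close> at which \<open>R * q\<close> equals
    \<open>(n * m)\<^sup>2 / R\<^sup>2\<close>.\<close>
  define \<rho> where "\<rho> = root 3 ((n * m)\<^sup>2 / q)"
  have \<rho>0: "\<rho> > 0" using pos by (simp add: \<rho>_def)
  have "\<rho> ^ 3 = (n * m)\<^sup>2 / q" using pos by (simp add: \<rho>_def)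
  then have \<rho>3: "\<rho> ^ 3 * q = (n * m)\<^sup>2" using pos by simp
  have key: "I \<le> 8 * q \<or> I \<le> 8 * \<rho> * q"
  proof -
    \<comment> \<open>The cell bound admits only \<open>R\<close> between 1 and both side lengths.
      Below that range \<open>R = 1\<close> is used instead; above it the trivial count along one
      side of the grid is already good enough.\<close>
    consider "\<rho> < 1" | "\<rho> > n" | "\<rho> > m" | "1 \<le> \<rho>" "\<rho> \<le> n" "\<rho> \<le> m" by linarith
    then show ?thesis
    proof cases
      case 1
      then have "\<rho> ^ 3 \<le> 1" using \<rho>0 by (intro power_le_one) auto
      then have "\<rho> ^ 3 * q \<le> 1 * q" using pos by (intro mult_right_mono) auto
      then have nm: "(n * m)\<^sup>2 \<le> q" using \<rho>3 by simp
      have "I \<le> 4 * 1 * q + 4 * (n * m)\<^sup>2 / 1\<^sup>2"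
        unfolding I_def n_def m_def q_def
        using card_incidences_cells_real[OF X Y L slope, of 1] pos by (simp add: n_def m_def)
      then show ?thesis using nm by simp
    next
      case 2
      have "I \<le> n * q" unfolding I_def n_def q_def
        using card_incidences_le_X[OF X L, of Y] by (metis of_nat_le_iff of_nat_mult)
      also have "\<dots> \<le> 8 * \<rho> * q" using 2 pos by (intro mult_right_mono) auto
      finally show ?thesis ..
    next
      case 3
      have "I \<le> m * q" unfolding I_def m_def q_def
        using card_incidences_le_Y[OF Y L slope, of X] by (metis of_nat_le_iff of_nat_mult)
      also have "\<dots> \<le> 8 * \<rho> * q" using 3 pos by (intro mult_right_mono) auto
      finally show ?thesis ..
    next
      case 4
      have "I \<le> 4 * \<rho> * q + 4 * (n * m)\<^sup>2 / \<rho>\<^sup>2"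
        unfolding I_def n_def m_def q_def
        using card_incidences_cells_real[OF X Y L slope, of \<rho>] 4 by (simp add: n_def m_def)
      also have "(n * m)\<^sup>2 = \<rho>\<^sup>2 * (\<rho> * q)"
        using \<rho>3 by (simp add: power2_eq_square power3_eq_cube mult_ac)
      finally show ?thesis using \<rho>0 by simp
    qed
  qed
  show ?thesis
  proof (cases "I \<le> 8 * q")
    case True
    then have "card (incidences X Y L) \<le> 8 * card L" unfolding I_def q_def by linarith
    then show ?thesis ..
  next
    case False
    then have "I ^ 3 \<le> (8 * \<rho> * q) ^ 3"
      using key by (intro power_mono) (auto simp: I_def)
    also have "\<dots> = 512 * q\<^sup>2 * (\<rho> ^ 3 * q)"
      by (simp add: power_mult_distrib power2_eq_square power3_eq_cube)
    also have "\<dots> = 512 * (q * n * m)\<^sup>2" unfolding \<rho>3 by (simp add: power_mult_distrib)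
    finally have "real (card (incidences X Y L) ^ 3) \<le> real (512 * (card L * card X * card Y)\<^sup>2)"
      unfolding I_def q_def n_def m_def by simp
    then show ?thesis unfolding of_nat_le_iff ..
  qed
qed

subsection \<open>Popular values and energies\<close>

text \<open>Summation by layers bounds the moment by twice the sum of \<open>h u / u\<close> over
  \<open>u\<close> up to \<open>N\<close>. Replacing \<open>h u\<close> by its maximum leaves a
  harmonic sum, the source of every logarithm. The case \<open>k = 2\<close> serves energies,
  \<open>k = 1\<close> plain counts.\<close>

lemma level_set_pigeonhole:
  fixes f :: "'a \<Rightarrow> nat"
  assumes S: "finite S" and N: "N \<ge> 1" and f: "\<And>s. s \<in> S \<Longrightarrow> f s \<le> N" and k: "k = 1 \<or> k = 2"
  obtains t where "1 \<le> t" "t \<le> N"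
    "real (\<Sum>s\<in>S. f s ^ k) \<le> 2 * harm N * (real t ^ k * real (card {s \<in> S. f s \<ge> t}))"
proof -
  define c where "c t = card {s \<in> S. f s \<ge> t}" for t
  define h where "h t = real t ^ k * real (c t)" for t
  define M where "M = Max (h ` {1..N})"
  have "M \<in> h ` {1..N}" unfolding M_def using N by (intro Max_in) auto
  then obtain t where t: "t \<in> {1..N}" "M = h t" by auto
  have le_M: "h u \<le> M" if "u \<in> {1..N}" for u
    unfolding M_def using that by (intro Max_ge) auto
  \<comment> \<open>For \<open>k = 2\<close> the right-hand side is \<open>n * (n + 1)\<close>; for
    \<open>k = 1\<close> it is \<open>2 * n\<close>.\<close>
  have pow: "n ^ k \<le> (\<Sum>u=1..n. 2 * u ^ (k - 1))" for n :: nat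
    using k by (induction n) (auto simp: power2_eq_square)
  have "(\<Sum>s\<in>S. f s ^ k) \<le> (\<Sum>s\<in>S. \<Sum>u=1..f s. 2 * u ^ (k - 1))"
    by (intro sum_mono pow)
  also have "\<dots> = (\<Sum>s\<in>S. \<Sum>u | u \<in> {1..N} \<and> u \<le> f s. 2 * u ^ (k - 1))"
  proof (rule sum.cong[OF refl])
    fix s assume "s \<in> S"
    then have "{1..f s} = {u. u \<in> {1..N} \<and> u \<le> f s}" using f[of s] by auto
    then show "(\<Sum>u=1..f s. 2 * u ^ (k - 1)) = (\<Sum>u | u \<in> {1..N} \<and> u \<le> f s. 2 * u ^ (k - 1))"
      by simp
  qed
  also have "\<dots> = (\<Sum>u=1..N. \<Sum>s | s \<in> S \<and> u \<le> f s. 2 * u ^ (k - 1))"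
    by (rule sum.swap_restrict) (use S in auto)
  also have "\<dots> = (\<Sum>u=1..N. 2 * u ^ (k - 1) * c u)" by (simp add: c_def mult_ac)
  finally have "real (\<Sum>s\<in>S. f s ^ k) \<le> real (\<Sum>u=1..N. 2 * u ^ (k - 1) * c u)"
    by (rule of_nat_mono)
  also have "\<dots> = (\<Sum>u=1..N. 2 * (h u * inverse (real u)))"
    using k by (auto simp: h_def power2_eq_square intro!: sum.cong)
  also have "\<dots> \<le> (\<Sum>u=1..N. 2 * (M * inverse (real u)))"
    using le_M by (intro sum_mono mult_left_mono mult_right_mono) auto
  also have "\<dots> = 2 * harm N * M" by (simp add: harm_def sum_distrib_left mult_ac)
  finally show ?thesis
    using that[of t] t unfolding h_def c_def by simp
qed

text \<open>The pairing \<open>(x\<^sub>1, x\<^sub>3), (x\<^sub>4, x\<^sub>2)\<close> turns \<open>x\<^sub>1 + x\<^sub>2 = x\<^sub>3 + x\<^sub>4\<close> into equality of differences and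
  \<open>x\<^sub>1 x\<^sub>2 = x\<^sub>3 x\<^sub>4\<close> into equality of quotients.\<close>

definition energy :: "(real \<Rightarrow> real \<Rightarrow> real) \<Rightarrow> real set \<Rightarrow> nat" where
  "energy d X = card {(x1, x2, x3, x4). x1 \<in> X \<and> x2 \<in> X \<and> x3 \<in> X \<and> x4 \<in> X \<and> d x1 x3 = d x4 x2}"

definition fibre :: "(real \<Rightarrow> real \<Rightarrow> real) \<Rightarrow> real set \<Rightarrow> real \<Rightarrow> (real \<times> real) set" where
  "fibre d X s = {(x, y). x \<in> X \<and> y \<in> X \<and> d x y = s}"

lemma finite_fibre: "finite X \<Longrightarrow> finite (fibre d X s)"
  by (rule finite_subset[of _ "X \<times> X"]) (auto simp: fibre_def)

lemma additive_energy_eq: "additive_energy X = energy (-) X"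
  unfolding additive_energy_def energy_def by (rule arg_cong[where f = card]) auto

lemma multiplicative_energy_eq: "0 \<notin> X \<Longrightarrow> multiplicative_energy X = energy (/) X"
proof -
  assume "0 \<notin> X"
  then have "x1 * x2 = x3 * x4 \<longleftrightarrow> x1 / x3 = x4 / x2" if "x2 \<in> X" "x3 \<in> X" for x1 x2 x3 x4
    using that frac_eq_eq[of x3 x2 x1 x4] by (auto simp: mult.commute)
  then show ?thesis
    unfolding multiplicative_energy_def energy_def by (intro arg_cong[where f = card]) blast
qed

lemma energy_eq_sum:
  assumes "finite X"
  shows "energy d X = (\<Sum>s\<in>case_prod d ` (X \<times> X). card (fibre d X s) ^ 2)"
proof -
  let ?S = "case_prod d ` (X \<times> X)"
  have "energy d X = card (SIGMA s : ?S. fibre d X s \<times> fibre d X s)"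
    unfolding energy_def
  proof (rule bij_betw_same_card)
    show "bij_betw (\<lambda>(x1, x2, x3, x4). (d x1 x3, (x1, x3), (x4, x2)))
      {(x1, x2, x3, x4). x1 \<in> X \<and> x2 \<in> X \<and> x3 \<in> X \<and> x4 \<in> X \<and> d x1 x3 = d x4 x2}
      (SIGMA s : ?S. fibre d X s \<times> fibre d X s)"
      by (rule bij_betw_byWitness[where f' = "\<lambda>(s, (x1, x3), (x4, x2)). (x1, x2, x3, x4)"])
        (auto simp: fibre_def)
  qed
  also have "\<dots> = (\<Sum>s\<in>?S. card (fibre d X s) ^ 2)"
    using assms finite_fibre[OF assms, of d]
    by (simp add: card_cartesian_product power2_eq_square)
  finally show ?thesis .
qed

lemma card_fibres:
  assumes "finite X" "finite S"
  shows "(\<Sum>s\<in>S. card (fibre d X s)) = card {(x, y). x \<in> X \<and> y \<in> X \<and> d x y \<in> S}"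
proof -
  have "(\<Sum>s\<in>S. card (fibre d X s)) = card (SIGMA s : S. fibre d X s)"
    using assms finite_fibre[OF assms(1), of d] by simp
  also have "\<dots> = card {(x, y). x \<in> X \<and> y \<in> X \<and> d x y \<in> S}"
    by (rule bij_betw_same_card[of snd], rule bij_betw_byWitness[where f' = "\<lambda>(x, y). (d x y, (x, y))"])
      (auto simp: fibre_def)
  finally show ?thesis .
qed

lemma card_fibre_le:
  assumes "finite X" "\<And>y. y \<in> X \<Longrightarrow> inj_on (\<lambda>x. d x y) X"
  shows "card (fibre d X s) \<le> card X"
proof (rule card_inj_on_le[where f = snd])
  show "inj_on snd (fibre d X s)"
    using assms(2) by (auto simp: fibre_def inj_on_def)
qed (use assms in \<open>auto simp: fibre_def\<close>)

text \<open>Only the trivial solutions \<open>d x y = d x y\<close> are counted. The bound later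
  absorbs the quadruples that contain zero.\<close>

lemma energy_ge_square:
  assumes "finite X"
  shows "card X ^ 2 \<le> energy d X"
proof -
  have "card (X \<times> X) \<le> energy d X" unfolding energy_def
  proof (rule card_inj_on_le[where f = "\<lambda>(x, y). (x, y, y, x)"])
    show "finite {(x1, x2, x3, x4). x1 \<in> X \<and> x2 \<in> X \<and> x3 \<in> X \<and> x4 \<in> X \<and> d x1 x3 = d x4 x2}"
      by (rule finite_subset[of _ "X \<times> X \<times> X \<times> X"]) (use assms in auto)
  qed (auto simp: inj_on_def)
  then show ?thesis by (simp add: card_cartesian_product power2_eq_square)
qed

text \<open>This covers both halves of the theorem: the energy of \<open>d\<close> on
  \<open>A\<close> is given, and that of \<open>e\<close> on a subset is to be bounded. By
  \<open>line\<close>, for fixed \<open>a\<close> and \<open>b\<close> the points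
  \<open>(d x a, e x b)\<close> lie on one line, and \<open>inj_line\<close> makes the lines of
  different pairs distinct.\<close>

locale energy_pair =
  fixes d e \<alpha> \<beta> :: "real \<Rightarrow> real \<Rightarrow> real" and Z :: "real set"
  assumes inj_d_right: "x \<in> Z \<Longrightarrow> inj_on (d x) Z"
    and inj_d_left: "a \<in> Z \<Longrightarrow> inj_on (\<lambda>x. d x a) Z"
    and inj_e_left: "b \<in> Z \<Longrightarrow> inj_on (\<lambda>x. e x b) Z"
    and line: "\<lbrakk>x \<in> Z; a \<in> Z; b \<in> Z\<rbrakk> \<Longrightarrow> e x b = \<alpha> a b * d x a + \<beta> a b"
    and slope_nonzero: "\<lbrakk>a \<in> Z; b \<in> Z\<rbrakk> \<Longrightarrow> \<alpha> a b \<noteq> 0"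
    and inj_line: "inj_on (\<lambda>(a, b). (\<alpha> a b, \<beta> a b)) (Z \<times> Z)"
begin

lemma level_set_bound:
  assumes A: "finite A" "A \<subseteq> Z" and B: "B \<subseteq> A" and P: "finite P" and S: "finite S"
    and q: "\<And>x. x \<in> B \<Longrightarrow> q \<le> card {a \<in> A. d x a \<in> P}"
    and t: "\<And>s. s \<in> S \<Longrightarrow> t \<le> card (fibre e B s)"
  shows "(q * t) ^ 3 * card S \<le> 512 * (card A * card B * card P)\<^sup>2"
proof (cases "S = {} \<or> B = {}")
  case True
  then show ?thesis
  proof
    assume "B = {}"
    then have "t = 0 \<or> S = {}" using t by (auto simp: fibre_def)
    then show ?thesis by auto
  qed auto
next
  case False
  \<comment> \<open>The hypotheses control \<open>q\<close> and \<open>t\<close> only through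
    elements of \<open>B\<close> and \<open>S\<close>, so witnesses are needed for
    \<open>q \<le> card P\<close> and \<open>t \<le> card B\<close>.\<close>
  then obtain s0 x0 where s0: "s0 \<in> S" and x0: "x0 \<in> B" by auto
  have finB: "finite B" using A B finite_subset by blast
  have BZ: "B \<subseteq> Z" using A B by auto
  have "q \<le> card {a \<in> A. d x0 a \<in> P}" using q x0 .
  also have "\<dots> \<le> card P"
  proof (rule card_inj_on_le)
    have "inj_on (d x0) Z" using x0 BZ by (intro inj_d_right) auto
    then show "inj_on (d x0) {a \<in> A. d x0 a \<in> P}"
      by (rule inj_on_subset) (use A in auto)
  qed (use P in auto)
  finally have qP: "q \<le> card P" .
  have "t \<le> card (fibre e B s0)" using t s0 .
  also have "\<dots> \<le> card B"
    using finB BZ inj_on_subset[OF inj_e_left] by (intro card_fibre_le) blast+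
  finally have tB: "t \<le> card B" .
  have BA: "card B \<le> card A" using A B by (intro card_mono)
  define L where "L = (\<lambda>(a, b). (\<alpha> a b, \<beta> a b)) ` (A \<times> B)"
  define U where "U = {(x, b). x \<in> B \<and> b \<in> B \<and> e x b \<in> S}"
  define T where "T = (SIGMA p : U. {a \<in> A. d (fst p) a \<in> P})"
  have finU: "finite U"
    by (rule finite_subset[of _ "B \<times> B"]) (use finB in \<open>auto simp: U_def\<close>)
  have "inj_on (\<lambda>(a, b). (\<alpha> a b, \<beta> a b)) (A \<times> B)"
    using inj_line by (rule inj_on_subset) (use A BZ in auto)
  then have cardL: "card L = card A * card B"
    unfolding L_def by (simp add: card_image card_cartesian_product)
  have finL: "finite L" unfolding L_def using A finB by simp
  have slope: "\<And>l. l \<in> L \<Longrightarrow> fst l \<noteq> 0"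
    unfolding L_def using slope_nonzero A BZ by fastforce
  have "q * (t * card S) = q * (\<Sum>s\<in>S. t)" by simp
  also have "\<dots> \<le> q * (\<Sum>s\<in>S. card (fibre e B s))"
    using t by (intro mult_left_mono sum_mono) auto
  also have "\<dots> = (\<Sum>p\<in>U. q)"
    using card_fibres[OF finB S, of e] by (simp add: U_def)
  also have "\<dots> \<le> (\<Sum>p\<in>U. card {a \<in> A. d (fst p) a \<in> P})"
    using q by (intro sum_mono) (auto simp: U_def)
  also have "\<dots> = card T" unfolding T_def using finU A by simp
  also have "\<dots> \<le> card (incidences P S L)"
  proof (rule card_inj_on_le)
    \<comment> \<open>An incidence determines its triple: the line gives back \<open>a\<close> and
      \<open>b\<close>, and then \<open>d x a\<close> gives back \<open>x\<close>.\<close>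
    let ?h = "\<lambda>((x, b), a). ((\<alpha> a b, \<beta> a b), d x a)"
    show "inj_on ?h T"
    proof (rule inj_onI)
      fix u v assume uv: "u \<in> T" "v \<in> T" "?h u = ?h v"
      obtain x b a where u: "u = ((x, b), a)" by (metis surj_pair)
      obtain x' b' a' where v: "v = ((x', b'), a')" by (metis surj_pair)
      have Z: "x \<in> Z" "b \<in> Z" "a \<in> Z" "x' \<in> Z" "b' \<in> Z" "a' \<in> Z"
        using uv(1,2) A BZ by (auto simp: u v T_def U_def)
      have eq: "\<alpha> a b = \<alpha> a' b'" "\<beta> a b = \<beta> a' b'" "d x a = d x' a'"
        using uv(3) by (simp_all add: u v)
      have ab: "(a, b) = (a', b')" by (rule inj_onD[OF inj_line]) (simp_all add: eq Z)
      then have "d x a = d x' a" using eq(3) by simp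
      from inj_onD[OF inj_d_left[OF Z(3)] this Z(1,4)] ab show "u = v" by (simp add: u v)
    qed
    show "?h ` T \<subseteq> incidences P S L"
    proof clarify
      fix x b a assume *: "((x, b), a) \<in> T"
      then have "x \<in> Z" "b \<in> Z" "a \<in> Z" using A BZ by (auto simp: T_def U_def)
      then have "\<alpha> a b * d x a + \<beta> a b = e x b" by (intro line[symmetric])
      with * show "((\<alpha> a b, \<beta> a b), d x a) \<in> incidences P S L"
        by (auto simp: T_def U_def incidences_def L_def)
    qed
  qed (use finite_incidences P finL in auto)
  finally have I: "q * t * card S \<le> card (incidences P S L)" by (simp add: mult.assoc)
  from szemeredi_trotter_grid[OF P S finL slope]
  show ?thesis
  proof
    \<comment> \<open>In this degenerate alternative one factor \<open>q * t\<close> goes into the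
      incidence bound. The remaining \<open>q\<^sup>2\<close> and \<open>t * t\<close> are estimated
      trivially by \<open>(card P)\<^sup>2\<close> and \<open>card A * card B\<close>.\<close>
    assume "card (incidences P S L) \<le> 8 * card L"
    with I have 1: "q * t * card S \<le> 8 * (card A * card B)" by (simp add: cardL)
    have "(q * t) ^ 3 * card S = (q * t * card S) * (q\<^sup>2 * (t * t))"
      by (simp add: power2_eq_square power3_eq_cube mult_ac)
    also have "\<dots> \<le> (8 * (card A * card B)) * ((card P)\<^sup>2 * (card A * card B))"
      using qP tB BA by (intro mult_mono[OF 1] mult_mono power_mono) auto
    also have "\<dots> \<le> 512 * (card A * card B * card P)\<^sup>2"
      by (simp add: power2_eq_square mult_ac)
    finally show ?thesis .
  next
    assume "card (incidences P S L) ^ 3 \<le> 512 * (card L * card P * card S)\<^sup>2"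
    then have "(q * t * card S) ^ 3 \<le> 512 * (card A * card B * card P * card S)\<^sup>2"
      unfolding cardL using power_mono[OF I, of 3] by linarith
    then have "((q * t) ^ 3 * card S) * (card S)\<^sup>2 \<le> (512 * (card A * card B * card P)\<^sup>2) * (card S)\<^sup>2"
      by (simp add: power2_eq_square power3_eq_cube mult_ac)
    moreover have "(card S)\<^sup>2 > 0" using s0 S by (auto simp: card_gt_0_iff)
    ultimately show ?thesis by (simp only: mult_le_cancel2)
  qed
qed

text \<open>Three pigeonhole choices fix the levels \<open>\<tau>\<close>, \<open>q\<close> and
  \<open>t\<close> that define \<open>P\<close>, \<open>B\<close> and \<open>S\<close>; then
  \<open>level_set_bound\<close> applies. The second estimate is squared so that the exponent 7/2
  becomes an integer.\<close>

lemma energy_subset: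
  assumes A: "finite A" "A \<subseteq> Z" "A \<noteq> {}"
  shows "\<exists>B\<subseteq>A. real (energy d A) \<le> 4 * harm (card A) ^ 2 * (real (card A))\<^sup>2 * card B \<and>
    (real (energy e B) * real (energy d A))\<^sup>2 \<le> 65536 * harm (card A) ^ 7 * real (card A) ^ 4 * real (card B) ^ 7"
proof -
  define N where "N = card A"
  define H :: real where "H = harm N"
  have N: "N \<ge> 1" using A by (simp add: N_def Suc_le_eq card_gt_0_iff)
  have H: "H > 0" using N by (simp add: H_def)
  define R where "R = case_prod d ` (A \<times> A)"
  have finR: "finite R" using A by (simp add: R_def)
  have fib: "card (fibre d A s) \<le> N" for s
    unfolding N_def using A inj_on_subset[OF inj_d_left] by (intro card_fibre_le) blast+
  obtain \<tau> where \<tau>: "1 \<le> \<tau>" "\<tau> \<le> N"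
    and E: "real (\<Sum>s\<in>R. card (fibre d A s) ^ 2)
        \<le> 2 * harm N * (real \<tau> ^ 2 * real (card {s \<in> R. card (fibre d A s) \<ge> \<tau>}))"
    using level_set_pigeonhole[OF finR N, of "\<lambda>s. card (fibre d A s)" 2] fib by auto
  define P where "P = {s \<in> R. card (fibre d A s) \<ge> \<tau>}"
  have finP: "finite P" using finR by (simp add: P_def)
  define p where "p = real (card P)"
  define E1 where "E1 = real (energy d A)"
  have E1: "E1 \<le> 2 * H * (\<tau>\<^sup>2 * p)"
    using E energy_eq_sum[OF A(1), of d] by (simp add: E1_def H_def P_def p_def R_def)
  define w where "w x = card {a \<in> A. d x a \<in> P}" for x
  have wN: "w x \<le> N" for x unfolding w_def N_def using A by (intro card_mono) auto
  obtain q where q: "1 \<le> q" "q \<le> N"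
    and Sw: "real (\<Sum>x\<in>A. w x ^ 1) \<le> 2 * harm N * (real q ^ 1 * real (card {x \<in> A. w x \<ge> q}))"
    using level_set_pigeonhole[OF A(1) N, of w 1] wN by auto
  define B where "B = {x \<in> A. w x \<ge> q}"
  define b where "b = real (card B)"
  have finB: "finite B" and BA: "B \<subseteq> A" using A by (auto simp: B_def)
  have "\<tau> * card P \<le> (\<Sum>s\<in>P. card (fibre d A s))"
    using sum_mono[of P "\<lambda>_. \<tau>" "\<lambda>s. card (fibre d A s)"] by (simp add: P_def mult.commute)
  also have "\<dots> = card {(x, y). x \<in> A \<and> y \<in> A \<and> d x y \<in> P}"
    by (rule card_fibres[OF A(1) finP])
  also have "{(x, y). x \<in> A \<and> y \<in> A \<and> d x y \<in> P} = (SIGMA x : A. {a \<in> A. d x a \<in> P})" by auto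
  also have "card \<dots> = (\<Sum>x\<in>A. w x)" using A by (simp add: w_def)
  finally have \<tau>P_sum: "\<tau> * card P \<le> (\<Sum>x\<in>A. w x)" .
  have \<tau>p_NN: "\<tau> * p \<le> real N ^ 2"
  proof -
    have "(\<Sum>x\<in>A. w x) \<le> (\<Sum>x\<in>A. N)" by (intro sum_mono wN)
    then have "\<tau> * card P \<le> N ^ 2" using \<tau>P_sum by (simp add: N_def power2_eq_square)
    then have "real (\<tau> * card P) \<le> real (N ^ 2)" by (rule of_nat_mono)
    then show ?thesis by (simp add: p_def)
  qed
  have \<tau>p_qb: "\<tau> * p \<le> 2 * H * (q * b)"
  proof -
    have "real (\<tau> * card P) \<le> real (\<Sum>x\<in>A. w x)" using \<tau>P_sum by (rule of_nat_mono)
    with Sw show ?thesis by (simp add: H_def p_def b_def B_def)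
  qed
  have first: "E1 \<le> 4 * H ^ 2 * real N ^ 2 * b"
  proof -
    have "E1 \<le> 2 * H * (\<tau> * (\<tau> * p))" using E1 by (simp add: power2_eq_square mult_ac)
    also have "\<dots> \<le> 2 * H * (\<tau> * (2 * H * (q * b)))"
      using \<tau>p_qb H by (intro mult_left_mono) auto
    also have "\<dots> \<le> 2 * H * (N * (2 * H * (N * b)))"
      using \<tau> q H by (intro mult_left_mono mult_mono mult_right_mono) (auto simp: b_def)
    also have "\<dots> = 4 * H ^ 2 * real N ^ 2 * b" by (simp add: power2_eq_square)
    finally show ?thesis .
  qed
  define V where "V = case_prod e ` (B \<times> B)"
  have finV: "finite V" using finB by (simp add: V_def)
  have fibB: "card (fibre e B s) \<le> N" for s
  proof -
    have "card (fibre e B s) \<le> card B"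
      using finB BA A inj_on_subset[OF inj_e_left] by (intro card_fibre_le) blast+
    also have "\<dots> \<le> N" unfolding N_def using A BA by (intro card_mono)
    finally show ?thesis .
  qed
  obtain t where t: "1 \<le> t" "t \<le> N"
    and E': "real (\<Sum>s\<in>V. card (fibre e B s) ^ 2)
        \<le> 2 * harm N * (real t ^ 2 * real (card {s \<in> V. card (fibre e B s) \<ge> t}))"
    using level_set_pigeonhole[OF finV N, of "\<lambda>s. card (fibre e B s)" 2] fibB by auto
  define S where "S = {s \<in> V. card (fibre e B s) \<ge> t}"
  have finS: "finite S" using finV by (simp add: S_def)
  define \<sigma> where "\<sigma> = real (card S)"
  define E2 where "E2 = real (energy e B)"
  have E2: "E2 \<le> 2 * H * (t\<^sup>2 * \<sigma>)"
    using E' energy_eq_sum[OF finB, of e] by (simp add: E2_def H_def S_def \<sigma>_def V_def)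
  have t\<sigma>: "t * \<sigma> \<le> b ^ 2"
  proof -
    have "t * card S \<le> (\<Sum>s\<in>S. card (fibre e B s))"
      using sum_mono[of S "\<lambda>_. t" "\<lambda>s. card (fibre e B s)"] by (simp add: S_def mult.commute)
    also have "\<dots> = card {(x, y). x \<in> B \<and> y \<in> B \<and> e x y \<in> S}"
      by (rule card_fibres[OF finB finS])
    also have "\<dots> \<le> card (B \<times> B)" using finB by (intro card_mono) auto
    finally have "real (t * card S) \<le> real (card B * card B)"
      unfolding card_cartesian_product by (rule of_nat_mono)
    then show ?thesis by (simp add: \<sigma>_def b_def power2_eq_square)
  qed
  have "(q * t) ^ 3 * card S \<le> 512 * (card A * card B * card P)\<^sup>2"
    by (rule level_set_bound[OF A(1,2) BA finP finS]) (auto simp: B_def w_def S_def)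
  then have "real ((q * t) ^ 3 * card S) \<le> real (512 * (card A * card B * card P)\<^sup>2)"
    by (rule of_nat_mono)
  then have st: "(q * t) ^ 3 * \<sigma> \<le> 512 * (N * b * p)\<^sup>2"
    by (simp add: N_def b_def p_def \<sigma>_def)
  have nn: "p \<ge> 0" "b \<ge> 0" "\<sigma> \<ge> 0" "E1 \<ge> 0" "E2 \<ge> 0"
    by (auto simp: p_def b_def \<sigma>_def E1_def E2_def)
  have second: "(E2 * E1)\<^sup>2 \<le> 65536 * H ^ 7 * real N ^ 4 * b ^ 7"
  proof (cases "p = 0")
    case True
    then have "E1 = 0" using E1 nn by simp
    then show ?thesis using H nn by simp
  next
    case False
    then have p: "p > 0" using nn by simp
    \<comment> \<open>Multiplying the incidence bound by \<open>t * \<sigma>\<close> produces the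
      square of \<open>t\<^sup>2 * \<sigma>\<close>, which controls the energy of
      \<open>B\<close>.\<close>
    have "q ^ 3 * (t\<^sup>2 * \<sigma>)\<^sup>2 = ((q * t) ^ 3 * \<sigma>) * (t * \<sigma>)"
      by (simp add: power2_eq_square power3_eq_cube mult_ac)
    also have "\<dots> \<le> (512 * (N * b * p)\<^sup>2) * b ^ 2"
      using nn by (intro mult_mono[OF st t\<sigma>]) auto
    finally have qS: "q ^ 3 * (t\<^sup>2 * \<sigma>)\<^sup>2 \<le> 512 * real N ^ 2 * b ^ 4 * p ^ 2"
      by (simp add: power_mult_distrib mult_ac power4_eq_xxxx power2_eq_square)
    \<comment> \<open>The cube of \<open>\<tau> * p\<close> brings in the factor
      \<open>q ^ 3\<close> that \<open>qS\<close> requires. It is cancelled at the end, which is why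
      \<open>p = 0\<close> was treated apart.\<close>
    have "(\<tau> * p) ^ 3 * (E2 * E1)\<^sup>2
        \<le> (2 * H * (q * b)) ^ 3 * ((2 * H * (t\<^sup>2 * \<sigma>)) * (2 * H * (\<tau>\<^sup>2 * p)))\<^sup>2"
      by (intro mult_mono[OF power_mono[OF \<tau>p_qb] power_mono[OF mult_mono[OF E2 E1]]])
        (use nn H in auto)
    also have "\<dots> = 128 * H ^ 7 * b ^ 3 * (\<tau> ^ 4 * p ^ 2) * (q ^ 3 * (t\<^sup>2 * \<sigma>)\<^sup>2)"
      by (simp add: power_mult_distrib mult_ac eval_nat_numeral)
    also have "\<dots> \<le> 128 * H ^ 7 * b ^ 3 * (\<tau> ^ 4 * p ^ 2) * (512 * real N ^ 2 * b ^ 4 * p ^ 2)"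
      using qS nn H by (intro mult_left_mono) auto
    also have "\<dots> = (\<tau> * p) ^ 3 * (65536 * H ^ 7 * real N ^ 2 * b ^ 7 * (\<tau> * p))"
      by (simp add: power_mult_distrib mult_ac eval_nat_numeral)
    finally have "(E2 * E1)\<^sup>2 \<le> 65536 * H ^ 7 * real N ^ 2 * b ^ 7 * (\<tau> * p)"
      using \<tau> p by (subst (asm) mult_le_cancel_left_pos) auto
    also have "\<dots> \<le> 65536 * H ^ 7 * real N ^ 2 * b ^ 7 * real N ^ 2"
      using \<tau>p_NN nn H by (intro mult_left_mono) auto
    also have "\<dots> = 65536 * H ^ 7 * real N ^ 4 * b ^ 7"
      by (simp add: mult_ac eval_nat_numeral)
    finally show ?thesis .
  qed
  from first second BA show ?thesis
    unfolding E1_def E2_def H_def N_def b_def by blast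
qed

end

subsection \<open>Removing zero\<close>

text \<open>The solutions with a zero coordinate form at most four two-parameter families, hence
  number at most \<open>4 * (card A)\<^sup>2\<close>. Since \<open>card A\<close> is at most twice
  \<open>card (A - {0})\<close>, this is at most \<open>16 * card Q'\<close>.\<close>

lemma card_quadruples_remove_zero:
  fixes A :: "real set"
  assumes A: "finite A" "card A \<ge> 2" and Q': "finite Q'" "(card (A - {0}))\<^sup>2 \<le> card Q'"
    and Q: "Q \<subseteq> Q' \<union> f1 ` (A \<times> A) \<union> f2 ` (A \<times> A) \<union> f3 ` (A \<times> A) \<union> f4 ` (A \<times> A)"
  shows "card Q \<le> 17 * card Q'"
proof -
  have im: "card (f ` (A \<times> A)) \<le> (card A)\<^sup>2" for f :: "real \<times> real \<Rightarrow> 'a"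
    using A card_image_le[of "A \<times> A" f] by (simp add: card_cartesian_product power2_eq_square)
  have "card Q \<le> card (Q' \<union> f1 ` (A \<times> A) \<union> f2 ` (A \<times> A) \<union> f3 ` (A \<times> A) \<union> f4 ` (A \<times> A))"
    using A Q' Q by (intro card_mono) auto
  also have "\<dots> \<le> card Q' + card (f1 ` (A \<times> A)) + card (f2 ` (A \<times> A))
      + card (f3 ` (A \<times> A)) + card (f4 ` (A \<times> A))"
    by (intro order.trans[OF card_Un_le] add_right_mono order.refl)
  also have "\<dots> \<le> card Q' + 4 * (card A)\<^sup>2"
    using im[of f1] im[of f2] im[of f3] im[of f4] by linarith
  also have "\<dots> \<le> card Q' + 4 * (2 * card (A - {0}))\<^sup>2"
    using A by (intro add_left_mono mult_left_mono power_mono) (auto simp: card_Diff_singleton_if)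
  also have "\<dots> \<le> 17 * card Q'" using Q'(2) by (simp add: power_mult_distrib)
  finally show ?thesis .
qed

lemma additive_energy_remove_zero:
  assumes A: "finite A" "card A \<ge> 2"
  shows "additive_energy A \<le> 17 * additive_energy (A - {0})"
  unfolding additive_energy_def
\<comment> \<open>One family for each position of the zero, with a further coordinate solved from
  the equation. Images that leave \<open>A\<close> do no harm, as only a covering is needed.\<close>
proof (rule card_quadruples_remove_zero[OF A,
    where ?f1.0 = "\<lambda>(x, y). (0, x, y, x - y)" and ?f2.0 = "\<lambda>(x, y). (x, 0, y, x - y)"
      and ?f3.0 = "\<lambda>(x, y). (x, y, 0, x + y)" and ?f4.0 = "\<lambda>(x, y). (x, y, x + y, 0)"], goal_cases)
  case 1
  show ?case
    by (rule finite_subset[of _ "A \<times> A \<times> A \<times> A"]) (use A in auto)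
next
  case 2
  show ?case
    using energy_ge_square[of "A - {0}" "(-)"] A
    unfolding additive_energy_eq[symmetric] additive_energy_def by simp
next
  case 3
  show ?case by (force simp: image_iff)
qed

lemma multiplicative_energy_remove_zero:
  assumes A: "finite A" "card A \<ge> 2"
  shows "multiplicative_energy A \<le> 17 * multiplicative_energy (A - {0})"
  unfolding multiplicative_energy_def
\<comment> \<open>If one product vanishes, so does the other. Each family fixes one zero factor on
  either side.\<close>
proof (rule card_quadruples_remove_zero[OF A,
    where ?f1.0 = "\<lambda>(x, y). (0, x, 0, y)" and ?f2.0 = "\<lambda>(x, y). (0, x, y, 0)"
      and ?f3.0 = "\<lambda>(x, y). (x, 0, 0, y)" and ?f4.0 = "\<lambda>(x, y). (x, 0, y, 0)"], goal_cases)
  case 1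
  show ?case
    by (rule finite_subset[of _ "A \<times> A \<times> A \<times> A"]) (use A in auto)
next
  case 2
  show ?case
    using energy_ge_square[of "A - {0}" "(/)"] A multiplicative_energy_eq[of "A - {0}"]
    unfolding multiplicative_energy_def by simp
next
  case 3
  show ?case by (force simp: image_iff)
qed

section \<open>Logarithmic form of the bounds and the two instances\<close>

lemma harm_le_ln:
  assumes "N \<ge> 2"
  shows "harm N \<le> 3 * ln (real N)"
proof -
  obtain n where n: "N = Suc n" using assms by (cases N) auto
  \<comment> \<open>The difference between harmonic number and logarithm decreases from its value 1
    at \<open>N = 1\<close>. For \<open>N \<ge> 2\<close> that 1 is at most
    \<open>2 * ln N\<close>.\<close>
  have "harm (Suc n) - ln (Suc n) \<le> harm (Suc 0) - ln (real (Suc 0))"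
    using decseqD[OF decseq_harm_diff_ln, of 0 n] by simp
  then have "harm N \<le> 1 + ln (real N)" by (simp add: n harm_def)
  moreover have "ln 2 \<le> ln (real N)" using assms by simp
  moreover have "(1::real) \<le> 2 * ln 2" using ln2_ge_two_thirds by simp
  ultimately show ?thesis by linarith
qed

text \<open>Here \<open>F\<close> stands for the energy of \<open>A\<close> itself, zero included.
  The constants are \<open>612 = 17 * 4 * 3^2\<close> and \<open>204544 = 17 * 256 * 47\<close>,
  where 47 rounds up the square root of \<open>3^7\<close>.\<close>

lemma (in energy_pair) energy_subset_lesssim:
  assumes A: "finite A" "card A \<ge> 2" and Z: "A - {0} \<subseteq> Z"
    and F: "F \<le> 17 * energy d (A - {0})"
  shows "\<exists>B\<subseteq>A - {0}. lesssim 612 2 A (real F / real (card A) ^ 2) (real (card B)) \<and>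
    lesssim 204544 (7/2) A (real (energy e B) * real F) (real (card B) powr (7/2) * real (card A) ^ 2)"
proof -
  define N where "N = card A"
  define \<Lambda> where "\<Lambda> = ln (real N)"
  have \<Lambda>: "\<Lambda> > 0" using A by (simp add: \<Lambda>_def N_def)
  have N: "N > 0" using A by (simp add: N_def)
  have "A - {0} \<noteq> {}"
  proof
    assume "A - {0} = {}"
    then have "card A \<le> card {0::real}" by (intro card_mono) auto
    then show False using A by simp
  qed
  then obtain B where B: "B \<subseteq> A - {0}"
    and 1: "real (energy d (A - {0})) \<le> 4 * harm (card (A - {0})) ^ 2 * (real (card (A - {0})))\<^sup>2 * card B"
    and 2: "(real (energy e B) * real (energy d (A - {0})))\<^sup>2
      \<le> 65536 * harm (card (A - {0})) ^ 7 * real (card (A - {0})) ^ 4 * real (card B) ^ 7"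
    using energy_subset[of "A - {0}"] A Z by auto
  define b where "b = real (card B)"
  have cardN: "card (A - {0}) \<le> N" unfolding N_def using A by (intro card_mono) auto
  have "harm (card (A - {0})) \<le> (harm N :: real)" using cardN by (rule harm_mono)
  also have "\<dots> \<le> 3 * \<Lambda>" unfolding \<Lambda>_def using A by (intro harm_le_ln) (simp add: N_def)
  finally have H: "harm (card (A - {0})) \<le> 3 * \<Lambda>" .
  have H0: "harm (card (A - {0})) \<ge> (0 :: real)" by (rule harm_nonneg)
  have F': "real F \<le> 17 * real (energy d (A - {0}))"
    using of_nat_mono[OF F, where 'a = real] by simp
  have "real (energy d (A - {0})) \<le> 4 * (3 * \<Lambda>) ^ 2 * (real N)\<^sup>2 * b"
    using 1 unfolding b_def
    by (rule order.trans) (intro mult_mono power_mono H H0 of_nat_mono cardN; use \<Lambda> H0 in simp)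
  with F' have "real F \<le> 612 * (b * \<Lambda>\<^sup>2) * (real N)\<^sup>2" by (simp add: power_mult_distrib mult_ac)
  then have "real F / (real N)\<^sup>2 \<le> 612 * (b * \<Lambda>\<^sup>2)" using N by (simp add: divide_le_eq)
  then have first: "lesssim 612 2 A (real F / real (card A) ^ 2) (real (card B))"
    unfolding lesssim_def using \<Lambda> by (simp add: N_def \<Lambda>_def b_def)
  have sq: "(x powr (7/2))\<^sup>2 = x ^ 7" if "x \<ge> 0" for x :: real
  proof (cases "x = 0")
    case False
    then have "(x powr (7/2))\<^sup>2 = x powr 7"
      by (simp add: power2_eq_square flip: powr_add)
    then show ?thesis using that False by simp
  qed simp
  have "(real (energy e B) * real F)\<^sup>2 \<le> (17 * (real (energy e B) * real (energy d (A - {0}))))\<^sup>2"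
    using mult_left_mono[OF F', of "real (energy e B)"] by (intro power_mono) (auto simp: mult_ac)
  also have "\<dots> = 289 * (real (energy e B) * real (energy d (A - {0})))\<^sup>2"
    unfolding power_mult_distrib[of 17] by simp
  also have "\<dots> \<le> 289 * (65536 * (3 * \<Lambda>) ^ 7 * real N ^ 4 * b ^ 7)"
  proof (rule mult_left_mono)
    show "(real (energy e B) * real (energy d (A - {0})))\<^sup>2 \<le> 65536 * (3 * \<Lambda>) ^ 7 * real N ^ 4 * b ^ 7"
      using 2 unfolding b_def
      by (rule order.trans) (intro mult_mono power_mono H H0 of_nat_mono cardN; use \<Lambda> H0 in simp)
  qed simp
  also have "\<dots> = (289 * 65536 * 2187) * (b ^ 7 * real N ^ 4 * \<Lambda> ^ 7)"
    by (simp add: power_mult_distrib)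
  also have "\<dots> \<le> 204544\<^sup>2 * (b ^ 7 * real N ^ 4 * \<Lambda> ^ 7)"
    using \<Lambda> by (intro mult_right_mono) (auto simp: b_def)
  also have "\<dots> = (204544 * (b powr (7/2) * (real N)\<^sup>2 * \<Lambda> powr (7/2)))\<^sup>2"
    using \<Lambda> by (simp add: power_mult_distrib sq b_def)
  finally have "real (energy e B) * real F \<le> 204544 * (b powr (7/2) * (real N)\<^sup>2 * \<Lambda> powr (7/2))"
    by (rule power2_le_imp_le) simp
  then have "lesssim 204544 (7/2) A (real (energy e B) * real F)
      (real (card B) powr (7/2) * real (card A) ^ 2)"
    by (simp add: lesssim_def N_def \<Lambda>_def b_def)
  with first B show ?thesis by blast
qed

text \<open>The set \<open>- {0}\<close> is the complement of zero. The lines come from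
  \<open>x - b = a * (x / a) - b\<close>, and in the next instance from
  \<open>x / b = (1 / b) * (x - a) + a / b\<close>.\<close>

interpretation quotient_difference: energy_pair "(/)" "(-)" "\<lambda>a b. a" "\<lambda>a b. - b" "- {0}"
  by unfold_locales (auto simp: inj_on_def)

interpretation difference_quotient: energy_pair "(-)" "(/)" "\<lambda>a b. 1 / b" "\<lambda>a b. a / b" "- {0}"
  by unfold_locales (auto simp: inj_on_def field_simps)

theorem theorem20:
  shows "(\<exists>C c C' c' :: real. C > 0 \<and> c > 0 \<and> C' > 0 \<and> c' > 0 \<and>
           (\<forall>A :: real set. finite A \<and> card A \<ge> 2 \<longrightarrow>
             (\<exists>A1 \<subseteq> A.
                lesssim C c A
                  (real (multiplicative_energy A) / real (card A) ^ 2)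
                  (real (card A1)) \<and>
                lesssim C' c' A
                  (real (additive_energy A1) * real (multiplicative_energy A))
                  (real (card A1) powr (7/2) * real (card A) ^ 2)))) \<and>
         (\<exists>C c C' c' :: real. C > 0 \<and> c > 0 \<and> C' > 0 \<and> c' > 0 \<and>
           (\<forall>A :: real set. finite A \<and> card A \<ge> 2 \<longrightarrow>
             (\<exists>A2 \<subseteq> A.
                lesssim C c A
                  (real (additive_energy A) / real (card A) ^ 2)
                  (real (card A2)) \<and>
                lesssim C' c' A
                  (real (multiplicative_energy A2) * real (additive_energy A))
                  (real (card A2) powr (7/2) * real (card A) ^ 2))))"
proof -
  have quotient: "\<exists>A1 \<subseteq> A. lesssim 612 2 A (real (multiplicative_energy A) / real (card A) ^ 2) (real (card A1)) \<and>
      lesssim 204544 (7/2) A (real (additive_energy A1) * real (multiplicative_energy A))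
        (real (card A1) powr (7/2) * real (card A) ^ 2)"
    if A: "finite A \<and> card A \<ge> 2" for A :: "real set"
  proof -
    have "multiplicative_energy A \<le> 17 * energy (/) (A - {0})"
      using multiplicative_energy_remove_zero[of A] A by (simp add: multiplicative_energy_eq)
    from quotient_difference.energy_subset_lesssim[OF _ _ _ this] A show ?thesis
      unfolding additive_energy_eq by blast
  qed
  have difference: "\<exists>A2 \<subseteq> A. lesssim 612 2 A (real (additive_energy A) / real (card A) ^ 2) (real (card A2)) \<and>
      lesssim 204544 (7/2) A (real (multiplicative_energy A2) * real (additive_energy A))
        (real (card A2) powr (7/2) * real (card A) ^ 2)"
    if A: "finite A \<and> card A \<ge> 2" for A :: "real set"
  proof -
    have "additive_energy A \<le> 17 * energy (-) (A - {0})"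
      using additive_energy_remove_zero[of A] A by (simp add: additive_energy_eq)
    from difference_quotient.energy_subset_lesssim[OF _ _ _ this] A
    obtain B where B: "B \<subseteq> A - {0}"
      "lesssim 612 2 A (real (additive_energy A) / real (card A) ^ 2) (real (card B))"
      "lesssim 204544 (7/2) A (real (energy (/) B) * real (additive_energy A))
        (real (card B) powr (7/2) * real (card A) ^ 2)"
      by blast
    \<comment> \<open>Passing from products to quotients requires a set without zero, so the
      inclusion of \<open>B\<close> in \<open>A - {0}\<close> is used here.\<close>
    moreover have "multiplicative_energy B = energy (/) B"
      using B(1) by (intro multiplicative_energy_eq) auto
    ultimately show ?thesis by (intro exI[of _ B]) auto
  qed
  show ?thesis
  proof (rule conjI, goal_cases)
    case 1
    show ?case
      by (rule exI[of _ 612], rule exI[of _ 2], rule exI[of _ 204544], rule exI[of _ "7/2"])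
        (use quotient in simp)
  next
    case 2
    show ?case
      by (rule exI[of _ 612], rule exI[of _ 2], rule exI[of _ 204544], rule exI[of _ "7/2"])
        (use difference in simp)
  qed
qed

end
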